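(* Let $\Sigma_0\in\mathcal M_Q^{\circ}$ have smallest symplectic eigenvalue $\nu_{\min}(\Sigma_0)$. The backward dilation orbit $\Sigma(s)=e^s\Sigma_0$, $s\le 0$, is quantum admissible (i.e. $\Sigma(s)\in\mathcal M_Q$) precisely when $$e^s\nu_{\min}(\Sigma_0)\ge\frac{\hbar}{2}.$$ As $s$ decreases from $0$, it first meets the boundary (the set of $\Sigma\in\mathcal M_Q$ with some symplectic eigenvalue equal to $\hbar/2$) at the finite parameter $$s_*=\log\frac{\hbar}{2\nu_{\min}(\Sigma_0)}<0.$$
   Context: Fix $N\ge1$ and $\hbar>0$. $\Omega=\bigoplus_{k=1}^N\begin{pmatrix}0&1\\-1&0\end{pmatrix}$. By Williamson's theorem every real symmetric positive definite $2N\times 2N$ matrix is $\Sigma=S_W(\bigoplus_{k}\nu_k\mathbb 1_2)S_W^{\mathsf T}$ with $S_W\Omega S_W^{\mathsf T}=\Omega$; the numbers $\nu_k>0$ are its symplectic eigenvalues. The quantum-admissible domain is $\mathcal M_Q=\{\Sigma\in\operatorname{Sym}_{++}(2N):\Sigma+\frac{i\hbar}{2}\Omega\ge0\}$, where $\operatorname{Sym}_{++}(2N)$ denotes the positive definite real symmetric $2N\times2N$ matrices, and $\mathcal M_Q^{\circ}=\{\Sigma\in\mathcal M_Q:\nu_k>\hbar/2\text{ for all }k\}$. *)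

theory Defs
  imports "HOL-Analysis.Analysis"
begin

text \<open>
  The number of modes \<open>N \<ge> 1\<close> is the cardinality of the finite index type \<open>'n\<close>. Phase space is
  indexed by \<open>'n \<times> 2\<close>: the index \<open>(k, a)\<close> is component \<open>a\<close> of mode \<open>k\<close>.
\<close>

type_synonym 'n phase_matrix = "real ^ ('n \<times> 2) ^ ('n \<times> 2)"

definition block_diag :: "('n::finite \<Rightarrow> real ^ 2 ^ 2) \<Rightarrow> 'n phase_matrix" where
  "block_diag A = (\<chi> i j. if fst i = fst j then A (fst i) $ snd i $ snd j else 0)"

definition symplectic_form :: "'n::finite phase_matrix" where
  "symplectic_form = block_diag (\<lambda>_. vector [vector [0, 1], vector [-1, 0]])"

definition pos_def_sym :: "(real ^ 'm ^ 'm) set" where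
  "pos_def_sym = {M. transpose M = M \<and> (\<forall>x. x \<noteq> 0 \<longrightarrow> 0 < x \<bullet> (M *v x))}"

definition hermitian_psd :: "complex ^ 'm ^ 'm \<Rightarrow> bool" where
  "hermitian_psd M \<longleftrightarrow>
     (\<forall>i j. M $ j $ i = cnj (M $ i $ j)) \<and>
     (\<forall>z. 0 \<le> Re (\<Sum>i\<in>UNIV. cnj (z $ i) * (M *v z) $ i))"

definition symplectic_matrix :: "'n::finite phase_matrix \<Rightarrow> bool" where
  "symplectic_matrix S \<longleftrightarrow> S ** symplectic_form ** transpose S = symplectic_form"

definition williamson_form ::
  "'n::finite phase_matrix \<Rightarrow> 'n phase_matrix \<Rightarrow> ('n \<Rightarrow> real) \<Rightarrow> bool" where
  "williamson_form \<Sigma> S \<nu> \<longleftrightarrow>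
     symplectic_matrix S \<and> (\<forall>k. 0 < \<nu> k) \<and>
     \<Sigma> = S ** block_diag (\<lambda>k. \<nu> k *\<^sub>R mat 1) ** transpose S"

text \<open>
  A Williamson form is unique up to the order of the \<open>\<nu> k\<close>, so the union over all forms of a
  positive definite \<open>\<Sigma>\<close> is the set of values \<open>\<nu> k\<close> of any single one of them.
\<close>

definition symplectic_eigenvalues :: "'n::finite phase_matrix \<Rightarrow> real set" where
  "symplectic_eigenvalues \<Sigma> = {\<nu> k | S \<nu> k. williamson_form \<Sigma> S \<nu>}"

definition min_symplectic_eigenvalue :: "'n::finite phase_matrix \<Rightarrow> real" where
  "min_symplectic_eigenvalue \<Sigma> = Min (symplectic_eigenvalues \<Sigma>)"

definition quantum_admissible :: "real \<Rightarrow> 'n::finite phase_matrix set" where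
  "quantum_admissible hbar =
     {\<Sigma> \<in> pos_def_sym.
        hermitian_psd (\<chi> i j. complex_of_real (\<Sigma> $ i $ j)
          + \<i> * complex_of_real (hbar / 2) * complex_of_real (symplectic_form $ i $ j))}"

definition quantum_interior :: "real \<Rightarrow> 'n::finite phase_matrix set" where
  "quantum_interior hbar =
     {\<Sigma> \<in> quantum_admissible hbar. \<forall>\<nu> \<in> symplectic_eigenvalues \<Sigma>. hbar / 2 < \<nu>}"

definition quantum_boundary :: "real \<Rightarrow> 'n::finite phase_matrix set" where
  "quantum_boundary hbar =
     {\<Sigma> \<in> quantum_admissible hbar. \<exists>\<nu> \<in> symplectic_eigenvalues \<Sigma>. \<nu> = hbar / 2}"

end

theory Submission
  imports Defs
begin

text \<open>
  Williamson's theorem is proved variationally: maximizing \<open>2 * w x y\<close> relative to \<open>B x x + B y y\<close>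
  yields a pair whose orthogonal complements for the positive form \<open>B\<close> and the symplectic form \<open>w\<close>
  coincide, so the pair can be split off and the construction repeated. In a Williamson form
  \<open>- (\<nu> k)\<^sup>2\<close> are the eigenvalues of \<open>(\<Omega> \<Sigma>)\<^sup>2\<close>, hence the set of symplectic eigenvalues does not
  depend on the form and is multiplied by \<open>c\<close> when \<open>\<Sigma>\<close> is. Splitting a complex vector into real and
  imaginary parts and changing variables symplectically decouples the admissibility condition into
  the conditions \<open>hbar / 2 \<le> \<nu> k\<close>, one for each mode.
\<close>

section \<open>Symplectic bases adapted to a positive definite form\<close>

text \<open>Both forms live on the whole space and subspaces are handled as sets, so the induction
  that splits off pairs never changes the type. For Williamson's theorem, \<open>B\<close> is the
  form of \<open>\<Sigma>\<close> and \<open>w\<close> that of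
  \<open>symplectic_form\<close>.\<close>

locale positive_and_alternating_form =
  B: bounded_bilinear B + w: bounded_bilinear w
  for B w :: "'a::euclidean_space \<Rightarrow> 'a \<Rightarrow> real" +
  assumes sym: "B x y = B y x"
    and pos: "x \<noteq> 0 \<Longrightarrow> 0 < B x x"
    and alt: "w x y = - w y x"
begin

lemma alt_self [simp]: "w x x = 0"
  using alt[of x x] by simp

definition nondegenerate_on :: "'a set \<Rightarrow> bool" where
  "nondegenerate_on V \<longleftrightarrow> (\<forall>x\<in>V. (\<forall>y\<in>V. w x y = 0) \<longrightarrow> x = 0)"

text \<open>The two identities are the stationarity equations at a maximizer of
  \<open>2 * w x y / (B x x + B y y)\<close> on \<open>V \<times> V\<close>, and
  \<open>\<mu>\<close> is the maximal value.\<close>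

lemma extremal_pair:
  assumes V: "subspace V" and nd: "nondegenerate_on V" and V0: "\<exists>x\<in>V. x \<noteq> 0"
  obtains \<mu> x y where "0 < \<mu>" "x \<in> V" "y \<in> V" "(x, y) \<noteq> 0"
    "\<And>h. h \<in> V \<Longrightarrow> w h y = \<mu> * B x h" "\<And>h. h \<in> V \<Longrightarrow> w x h = \<mu> * B y h"
proof -
  define q where "q = (\<lambda>p. B (fst p) (fst p) + B (snd p) (snd p))"
  define r where "r = (\<lambda>p. w (fst p) (snd p))"
  have VV: "subspace (V \<times> V)" using V by (simp add: subspace_Times)
  have qpos: "0 < q p" if "p \<noteq> 0" for p
  proof -
    have nonneg: "0 \<le> B z z" for z
      using pos[of z] by (cases "z = 0") (auto simp: B.zero_left)
    have "fst p \<noteq> 0 \<or> snd p \<noteq> 0" using that by (simp add: prod_eq_iff)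
    then show ?thesis
      using pos nonneg unfolding q_def by (metis add_nonneg_pos add_pos_nonneg)
  qed
  \<comment> \<open>The quotient is homogeneous of degree zero, so its maximum over the compact unit
    sphere of \<open>V \<times> V\<close> is global.\<close>
  let ?K = "sphere 0 1 \<inter> (V \<times> V)"
  have comp: "compact ?K"
    using closed_subspace[OF VV] compact_sphere by (metis compact_Int_closed)
  obtain x1 where x1: "x1 \<in> V" "x1 \<noteq> 0" using V0 by auto
  obtain y1 where y1: "y1 \<in> V" "w x1 y1 \<noteq> 0"
    using nd x1 unfolding nondegenerate_on_def by blast
  have ne: "?K \<noteq> {}"
  proof -
    have z: "(x1, y1) \<noteq> 0" using x1 by (simp add: prod_eq_iff)
    have "(1 / norm (x1, y1)) *\<^sub>R (x1, y1) \<in> V \<times> V"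
      by (rule subspace_mul[OF VV]) (use x1 y1 in simp)
    moreover have "norm ((1 / norm (x1, y1)) *\<^sub>R (x1, y1)) = 1"
      unfolding norm_scaleR using z by (simp del: scaleR_Pair)
    ultimately have "(1 / norm (x1, y1)) *\<^sub>R (x1, y1) \<in> ?K"
      by (simp only: Int_iff mem_sphere_0 simp_thms)
    then show ?thesis by (rule ex_in_conv[THEN iffD1, OF exI])
  qed
  have nz: "q p \<noteq> 0" if "p \<in> ?K" for p
  proof -
    have "norm p = 1" using that by (simp only: Int_iff mem_sphere_0)
    then show ?thesis using qpos[of p] by fastforce
  qed
  have "continuous_on ?K (\<lambda>p. r p / q p)"
    unfolding r_def q_def
    by (intro continuous_intros w.continuous_on B.continuous_on)
      (use nz in \<open>simp add: q_def\<close>)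
  then obtain p0 where p0: "p0 \<in> ?K" "\<And>p. p \<in> ?K \<Longrightarrow> r p / q p \<le> r p0 / q p0"
    using continuous_attains_sup[OF comp ne] by blast
  \<comment> \<open>The factor 2 is the one produced by polarizing \<open>q\<close>; it leaves the
    stationarity equations free of constants.\<close>
  define \<mu> where "\<mu> = 2 * (r p0 / q p0)"
  obtain x0 y0 where xy: "p0 = (x0, y0)" by (cases p0)
  have p0n: "p0 \<noteq> 0" using p0 by auto
  have in0: "x0 \<in> V" "y0 \<in> V" using p0 xy by auto
  have max: "2 * r p \<le> \<mu> * q p" if p: "p \<in> V \<times> V" for p
  proof (cases "p = 0")
    case True then show ?thesis by (simp add: r_def q_def w.zero_left B.zero_left)
  next
    case False
    define c where "c = 1 / norm p"
    have c: "c > 0" using False by (simp add: c_def)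
    have "c *\<^sub>R p \<in> ?K"
      using subspace_mul[OF VV p, of c] False by (auto simp: c_def)
    from p0(2)[OF this] have "r (c *\<^sub>R p) / q (c *\<^sub>R p) \<le> r p0 / q p0" .
    moreover have "r (c *\<^sub>R p) = c\<^sup>2 * r p" "q (c *\<^sub>R p) = c\<^sup>2 * q p"
      by (simp_all add: r_def q_def w.scaleR_left w.scaleR_right B.scaleR_left B.scaleR_right
          power2_eq_square algebra_simps)
    ultimately have "r p / q p \<le> r p0 / q p0" using c by simp
    then have "r p \<le> (r p0 / q p0) * q p"
      using qpos[OF False] by (simp only: pos_divide_le_eq)
    then have "2 * r p \<le> 2 * ((r p0 / q p0) * q p)" by linarith
    then show ?thesis by (simp only: \<mu>_def mult.assoc)
  qed
  \<comment> \<open>Nondegeneracy provides a pair with \<open>w\<close> nonzero; flipping the sign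
    of one vector makes it positive, hence also the maximum.\<close>
  have mu_pos: "0 < \<mu>"
  proof -
    obtain y2 where y2: "y2 \<in> V" "w x1 y2 > 0"
    proof (cases "w x1 y1 > 0")
      case True then show ?thesis using y1 that by blast
    next
      case False
      then show ?thesis using y1 that[of "- y1"] V
        by (auto simp: w.minus_right subspace_neg)
    qed
    have "0 < \<mu> * q (x1, y2)"
      using max[of "(x1, y2)"] x1 y2 by (simp add: r_def)
    moreover have "0 < q (x1, y2)" using qpos[of "(x1,y2)"] x1 by (simp add: zero_prod_def)
    ultimately show ?thesis by (simp add: zero_less_mult_iff)
  qed
  \<comment> \<open>\<open>p0\<close> is a null vector of the positive semidefinite form \<open>\<mu> * q - 2 * r\<close> on \<open>V \<times> V\<close>,
    hence lies in its kernel.\<close>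
  have key: "\<mu> * (B x0 h + B y0 k) = w x0 k + w h y0" if hk: "h \<in> V" "k \<in> V" for h k
  proof -
    define L where "L = \<mu> * (B x0 h + B y0 k) - w x0 k - w h y0"
    define Q where "Q = \<mu> * q (h, k) - 2 * r (h, k)"
    have eq0: "\<mu> * q p0 = 2 * r p0" using qpos[OF p0n] by (simp add: \<mu>_def)
    have ineq: "0 \<le> 2 * t * L + t\<^sup>2 * Q" for t
    proof -
      have "(x0 + t *\<^sub>R h, y0 + t *\<^sub>R k) \<in> V \<times> V"
        using in0 hk V by (simp add: subspace_add subspace_mul)
      from max[OF this] show ?thesis using eq0 sym[of h x0] sym[of k y0]
        by (simp add: L_def Q_def q_def r_def xy B.add_left B.add_right w.add_left w.add_right
            B.scaleR_left B.scaleR_right w.scaleR_left w.scaleR_right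
            power2_eq_square algebra_simps)
    qed
    have "L = 0"
    proof (rule ccontr)
      assume L: "L \<noteq> 0"
      \<comment> \<open>Evaluating at \<open>t = - L / d\<close> with \<open>d > Q\<close> and
        \<open>d > 0\<close> makes the linear term \<open>-2 L^2 / d\<close> outweigh the quadratic
        term, which is at most \<open>L^2 / d\<close>.\<close>
      define d where "d = \<bar>Q\<bar> + 1"
      have d: "0 < d" by (simp add: d_def)
      have "0 \<le> 2 * (- L / d) * L + (- L / d)\<^sup>2 * Q" by (rule ineq)
      also have "\<dots> \<le> 2 * (- L / d) * L + (- L / d)\<^sup>2 * d"
        by (intro add_left_mono mult_left_mono) (auto simp: d_def)
      also have "\<dots> = - (L\<^sup>2 / d)"
        using d by (simp add: field_simps power2_eq_square)
      finally show False using L by (simp add: d_def divide_le_0_iff)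
    qed
    then show ?thesis by (simp add: L_def)
  qed
  show ?thesis
  proof (rule that[OF mu_pos in0])
    show "(x0, y0) \<noteq> 0" using p0n xy by simp
    show "w h y0 = \<mu> * B x0 h" if "h \<in> V" for h
      using key[OF that subspace_0[OF V]] by (simp add: B.zero_right w.zero_right)
    show "w x0 h = \<mu> * B y0 h" if "h \<in> V" for h
      using key[OF subspace_0[OF V] that] by (simp add: B.zero_right w.zero_left)
  qed
qed

text \<open>An extremal pair is rescaled so that \<open>w x y = 1\<close>, which turns
  \<open>\<mu>\<close> into \<open>\<nu> = 1 / \<mu>\<close>. By the last two identities,
  orthogonality to both \<open>x\<close> and \<open>y\<close> means the same within \<open>V\<close>
  for \<open>B\<close> and for \<open>w\<close>.\<close>

lemma canonical_pair:
  assumes V: "subspace V" and nd: "nondegenerate_on V" and V0: "\<exists>x\<in>V. x \<noteq> 0"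
  obtains \<nu> x y where "0 < \<nu>" "x \<in> V" "y \<in> V" "w x y = 1" "B x x = \<nu>" "B y y = \<nu>" "B x y = 0"
    "\<And>h. h \<in> V \<Longrightarrow> B x h = \<nu> * w h y" "\<And>h. h \<in> V \<Longrightarrow> B y h = \<nu> * w x h"
proof -
  obtain \<mu> x y where \<mu>: "0 < \<mu>" and xy: "x \<in> V" "y \<in> V" "(x, y) \<noteq> 0"
    and hy: "\<And>h. h \<in> V \<Longrightarrow> w h y = \<mu> * B x h" and hx: "\<And>h. h \<in> V \<Longrightarrow> w x h = \<mu> * B y h"
    using extremal_pair[OF assms] by metis
  \<comment> \<open>Both sides equal \<open>w x y / \<mu>\<close>: take \<open>h = x\<close> in the
    first identity and \<open>h = y\<close> in the second.\<close>
  have eq: "B x x = B y y" using hy[OF xy(1)] hx[OF xy(2)] \<mu> by simp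
  have orth: "B x y = 0" using hy[OF xy(2)] \<mu> by simp
  have b: "0 < B x x" using xy(3) pos[of x] pos[of y] eq by (auto simp: zero_prod_def)
  define c where "c = 1 / sqrt (\<mu> * B x x)"
  have c: "c * c * (\<mu> * B x x) = 1" "c \<noteq> 0"
    using \<mu> b by (auto simp: c_def)
  show ?thesis
  proof (rule that[of "1 / \<mu>" "c *\<^sub>R x" "c *\<^sub>R y"])
    show "0 < 1 / \<mu>" using \<mu> by simp
    show "c *\<^sub>R x \<in> V" "c *\<^sub>R y \<in> V" using xy V by (auto simp: subspace_mul)
    show "w (c *\<^sub>R x) (c *\<^sub>R y) = 1"
      using c hy[OF xy(1)] by (simp add: w.scaleR_left w.scaleR_right mult.assoc)
    show "B (c *\<^sub>R x) (c *\<^sub>R x) = 1 / \<mu>" "B (c *\<^sub>R y) (c *\<^sub>R y) = 1 / \<mu>"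
      using c \<mu> eq by (simp_all add: B.scaleR_left B.scaleR_right field_simps)
    show "B (c *\<^sub>R x) (c *\<^sub>R y) = 0"
      using orth by (simp add: B.scaleR_left B.scaleR_right)
    show "B (c *\<^sub>R x) h = 1 / \<mu> * w h (c *\<^sub>R y)" if "h \<in> V" for h
      using hy[OF that] \<mu> by (simp add: B.scaleR_left w.scaleR_right)
    show "B (c *\<^sub>R y) h = 1 / \<mu> * w (c *\<^sub>R x) h" if "h \<in> V" for h
      using hx[OF that] \<mu> by (simp add: B.scaleR_left w.scaleR_left)
  qed
qed

text \<open>A Darboux family for \<open>w\<close> that also diagonalizes \<open>B\<close>, with the
  same entry for both members of a pair.\<close>

definition canonical_on :: "'k set \<Rightarrow> ('k \<Rightarrow> 'a) \<Rightarrow> ('k \<Rightarrow> 'a) \<Rightarrow> ('k \<Rightarrow> real) \<Rightarrow> bool" where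
  "canonical_on K e f \<nu> \<longleftrightarrow> (\<forall>j\<in>K. 0 < \<nu> j \<and>
    (\<forall>l\<in>K. B (e j) (e l) = (if j = l then \<nu> j else 0) \<and>
           B (f j) (f l) = (if j = l then \<nu> j else 0) \<and>
           B (e j) (f l) = 0 \<and> w (e j) (e l) = 0 \<and> w (f j) (f l) = 0 \<and>
           w (e j) (f l) = (if j = l then 1 else 0)))"

text \<open>Each induction step splits off one canonical pair and continues in its common
  complement. The dimension hypothesis is an inequality, so it is enough to know that a step loses
  at most two dimensions.\<close>

lemma symplectic_basis:
  fixes K :: "'k set"
  assumes "finite K" "subspace V" "nondegenerate_on V" "2 * card K \<le> dim V"
  shows "\<exists>e f \<nu>. e ` K \<subseteq> V \<and> f ` K \<subseteq> V \<and> canonical_on K e f \<nu>"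
  using assms
proof (induction K arbitrary: V rule: finite_induct)
  case empty
  show ?case by (simp add: canonical_on_def)
next
  case (insert k K)
  note V = insert.prems(1)
  have "card (insert k K) = Suc (card K)"
    using insert.hyps by simp
  then have "dim V \<noteq> 0"
    using insert.prems(3) by linarith
  then have "\<exists>x\<in>V. x \<noteq> 0" unfolding dim_eq_0 by blast
  from canonical_pair[OF V insert.prems(2) this]
  obtain n x y where n: "0 < n" and xy: "x \<in> V" "y \<in> V" and wxy: "w x y = 1"
    and Bx: "B x x = n" and By: "B y y = n" and Bxy: "B x y = 0"
    and hx: "\<And>h. h \<in> V \<Longrightarrow> B x h = n * w h y" and hy: "\<And>h. h \<in> V \<Longrightarrow> B y h = n * w x h"
    by metis
  define V' where "V' = {h \<in> V. B x h = 0 \<and> B y h = 0}"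
  have V': "subspace V'"
    using V unfolding V'_def subspace_def
    by (auto simp: B.add_right B.scaleR_right B.zero_right)
  \<comment> \<open>The complement was defined through \<open>B\<close>; the identities for the
    canonical pair make it \<open>w\<close>-orthogonal to \<open>x\<close> and \<open>y\<close> as
    well.\<close>
  have wV': "w h x = 0" "w h y = 0" "w x h = 0" "w y h = 0"
    "B x h = 0" "B y h = 0" "B h x = 0" "B h y = 0" if "h \<in> V'" for h
    using that hx[of h] hy[of h] n sym[of h x] sym[of h y] alt[of h x] alt[of h y]
    by (auto simp: V'_def)
  \<comment> \<open>On \<open>V\<close> this is the \<open>B\<close>-orthogonal projection onto
    \<open>V'\<close>, since \<open>x\<close> and \<open>y\<close> are \<open>B\<close>-orthogonal
    with \<open>B x x = B y y = n\<close>.\<close>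
  define P where "P = (\<lambda>v. v - (B x v / n) *\<^sub>R x - (B y v / n) *\<^sub>R y)"
  have P: "P v \<in> V'" if "v \<in> V" for v
    unfolding V'_def P_def using that xy V n Bx By Bxy sym[of y x]
    by (auto simp: subspace_diff subspace_mul B.diff_right B.scaleR_right)
  have split: "v = P v + (B x v / n) *\<^sub>R x + (B y v / n) *\<^sub>R y" for v
    by (simp add: P_def)
  have nd': "nondegenerate_on V'"
    unfolding nondegenerate_on_def
  proof (intro ballI impI)
    fix z assume z: "z \<in> V'" and z0: "\<forall>u\<in>V'. w z u = 0"
    \<comment> \<open>A vector of \<open>V'\<close> already pairs to zero with \<open>x\<close> and
      \<open>y\<close>, so vanishing against \<open>V'\<close> extends to all of \<open>V\<close>,
      where \<open>w\<close> is nondegenerate.\<close>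
    have "w z v = 0" if "v \<in> V" for v
    proof -
      have "w z v = w z (P v + (B x v / n) *\<^sub>R x + (B y v / n) *\<^sub>R y)"
        using split[of v] by simp
      also have "\<dots> = 0"
        using z0 P[OF that] wV'[OF z] by (simp add: w.add_right w.scaleR_right)
      finally show ?thesis .
    qed
    moreover have "z \<in> V" using z by (simp add: V'_def)
    ultimately show "z = 0" using insert.prems(2) unfolding nondegenerate_on_def by blast
  qed
  have "V \<subseteq> span (insert x (insert y V'))"
  proof
    fix v assume "v \<in> V"
    then have "P v \<in> span (insert x (insert y V'))"
      using P by (simp add: span_base)
    then show "v \<in> span (insert x (insert y V'))"
      by (subst split) (auto intro!: span_add span_mul intro: span_base)
  qed
  then have "dim V \<le> dim (insert x (insert y V'))"
    by (metis dim_subset dim_span)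
  also have "\<dots> \<le> dim V' + 2"
    by (simp add: dim_insert)
  finally have "2 * card K \<le> dim V'"
    using insert.prems(3) insert.hyps by simp
  from insert.IH[OF V' nd' this] obtain e f \<nu> 
    where IH: "e ` K \<subseteq> V'" "f ` K \<subseteq> V'" "canonical_on K e f \<nu>"
    by (elim exE conjE)
  have sub: "V' \<subseteq> V" by (auto simp: V'_def)
  have neq: "j \<noteq> k" if "j \<in> K" for j using that insert.hyps by blast
  have in': "e j \<in> V'" "f j \<in> V'" if "j \<in> K" for j using IH that by auto
  show ?case
  proof (intro exI conjI)
    show "(e(k := x)) ` insert k K \<subseteq> V" "(f(k := y)) ` insert k K \<subseteq> V"
      using IH sub xy by auto
    show "canonical_on (insert k K) (e(k := x)) (f(k := y)) (\<nu>(k := n))"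
      using IH(3) neq n wxy Bx By Bxy unfolding canonical_on_def
      by (auto simp: wV'[OF in'(1)] wV'[OF in'(2)])
  qed
qed

end

section \<open>The symplectic form and Williamson forms\<close>

lemma matrix_vector_mult_minus_left: "(- A) *v x = - (A *v x)"
  for A :: "'a::ring_1 ^ 'n ^ 'm"
  by (simp add: vec_eq_iff matrix_vector_mult_def sum_negf)

lemma matrix_vector_mult_minus_right: "A *v (- x) = - (A *v x)"
  for A :: "'a::ring_1 ^ 'n ^ 'm"
  by (simp add: vec_eq_iff matrix_vector_mult_def sum_negf)

lemma matrix_mult_minus_left: "(- A) ** C = - (A ** C)"
  for A :: "'a::ring_1 ^ 'n ^ 'm"
  by (simp add: vec_eq_iff matrix_matrix_mult_def sum_negf)

lemma matrix_mult_minus_right: "A ** (- C) = - (A ** C)"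
  for A :: "'a::ring_1 ^ 'n ^ 'm"
  by (simp add: vec_eq_iff matrix_matrix_mult_def sum_negf)

lemma axis_component: "axis i x $ j = (if j = i then x else 0)"
  by (simp add: axis_def)

lemma sum_modes:
  fixes g :: "'n::finite \<times> 2 \<Rightarrow> 'b::comm_monoid_add"
  shows "(\<Sum>p\<in>UNIV. g p) = (\<Sum>k\<in>UNIV. g (k, 1) + g (k, 2))"
proof -
  have "(\<Sum>p\<in>UNIV. g p) = (\<Sum>k\<in>UNIV. \<Sum>a\<in>UNIV. g (k, a))"
    by (simp add: sum.cartesian_product flip: UNIV_Times_UNIV)
  then show ?thesis by (simp add: sum_2)
qed

lemma block_diag_scale_mult_vec:
  "(block_diag (\<lambda>k. \<nu> k *\<^sub>R mat 1) *v u) $ p = \<nu> (fst p) * u $ p"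
proof -
  have "(block_diag (\<lambda>k. \<nu> k *\<^sub>R mat 1) *v u) $ p
     = (\<Sum>q\<in>UNIV. if p = q then \<nu> (fst p) * u $ q else 0)"
    unfolding matrix_vector_mult_def block_diag_def
    by (auto intro!: sum.cong simp: mat_def prod_eq_iff)
  then show ?thesis by simp
qed

lemma symplectic_form_mult_vec:
  "(symplectic_form *v u) $ (k, 1) = u $ (k, 2)"
  "(symplectic_form *v u) $ (k, 2) = - u $ (k, 1)"
proof -
  have "(symplectic_form *v u) $ (k, 1) = (\<Sum>l\<in>UNIV. if k = l then u $ (l, 2) else 0)"
    "(symplectic_form *v u) $ (k, 2) = (\<Sum>l\<in>UNIV. if k = l then - u $ (l, 1) else 0)"
    unfolding matrix_vector_mult_def vec_lambda_beta sum_modes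
    by (rule sum.cong[OF refl], simp add: symplectic_form_def block_diag_def)+
  then show "(symplectic_form *v u) $ (k, 1) = u $ (k, 2)"
    "(symplectic_form *v u) $ (k, 2) = - u $ (k, 1)" by simp_all
qed

lemma inner_modes:
  fixes u v :: "real ^ ('n::finite \<times> 2)"
  shows "u \<bullet> v = (\<Sum>k\<in>UNIV. u $ (k, 1) * v $ (k, 1) + u $ (k, 2) * v $ (k, 2))"
  by (simp add: inner_vec_def sum_modes)

lemma vec_eq_modes_iff:
  fixes u v :: "real ^ ('n::finite \<times> 2)"
  shows "u = v \<longleftrightarrow> (\<forall>k. u $ (k, 1) = v $ (k, 1) \<and> u $ (k, 2) = v $ (k, 2))"
  unfolding vec_eq_iff split_paired_All forall_2 ..

lemma symplectic_form_twice: "symplectic_form *v (symplectic_form *v u) = - u"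
  by (simp add: vec_eq_modes_iff symplectic_form_mult_vec)

lemma symplectic_form_squared: "symplectic_form ** symplectic_form = - mat 1"
  by (rule matrix_eq[THEN iffD2])
    (simp add: symplectic_form_twice matrix_vector_mult_minus_left flip: matrix_vector_mul_assoc)

lemma symplectic_form_alternating:
  "x \<bullet> (symplectic_form *v y) = - (y \<bullet> (symplectic_form *v x))"
  by (simp add: inner_modes symplectic_form_mult_vec sum_negf[symmetric] algebra_simps)

lemma matrix_eq_of_forms:
  fixes A C :: "real ^ 'm ^ 'm"
  assumes "\<And>i j. axis i 1 \<bullet> (A *v axis j 1) = axis i 1 \<bullet> (C *v axis j 1)"
  shows "A = C"
  using assms by (simp add: vec_eq_iff inner_axis' matrix_vector_mult_basis column_def)

lemma inner_transpose_mult: "x \<bullet> (transpose A *v y) = (A *v x) \<bullet> y"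
  for A :: "real ^ 'm ^ 'n"
  by (metis dot_lmul_matrix inner_commute transpose_matrix_vector)

lemma inner_congruence:
  fixes A T :: "real ^ 'm ^ 'm"
  shows "x \<bullet> ((transpose T ** A ** T) *v y) = (T *v x) \<bullet> (A *v (T *v y))"
  by (simp only: matrix_vector_mul_assoc[symmetric] inner_transpose_mult)

text \<open>The canonical basis forms the columns of a matrix \<open>T\<close> whose congruence
  diagonalizes \<open>\<Sigma>\<close> and fixes the symplectic form. Inverting the congruence gives
  the Williamson form with the transposed inverse of \<open>T\<close>.\<close>

theorem williamson:
  fixes \<Sigma> :: "'n::finite phase_matrix"
  assumes "\<Sigma> \<in> pos_def_sym"
  obtains S \<nu> where "williamson_form \<Sigma> S \<nu>"
proof -
  define B where "B = (\<lambda>x y. x \<bullet> (\<Sigma> *v y))"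
  define w where "w = (\<lambda>x y :: real ^ ('n \<times> 2). x \<bullet> (symplectic_form *v y))"
  have bil: "bounded_bilinear (\<lambda>x y. x \<bullet> (A *v y))" for A :: "'n phase_matrix"
    unfolding bilinear_conv_bounded_bilinear[symmetric] bilinear_def
    by (auto intro!: linearI simp: algebra_simps matrix_vector_right_distrib
        matrix_vector_mult_scaleR)
  have "x \<bullet> (\<Sigma> *v y) = y \<bullet> (\<Sigma> *v x)" for x y
    using assms inner_transpose_mult[of x \<Sigma> y]
    by (simp add: pos_def_sym_def inner_commute del: transpose_matrix_vector)
  then interpret positive_and_alternating_form B w
    using assms bil symplectic_form_alternating
    by unfold_locales
      (auto simp: B_def w_def pos_def_sym_def bounded_bilinear_def)
  have "nondegenerate_on UNIV"
    unfolding nondegenerate_on_def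
  proof (intro ballI impI)
    fix x :: "real ^ ('n \<times> 2)" assume "\<forall>y\<in>UNIV. w x y = 0"
    \<comment> \<open>The symplectic form squares to minus the identity, so this test vector yields
      \<open>x \<bullet> x = 0\<close>.\<close>
    then have "w x (- (symplectic_form *v x)) = 0" by blast
    then show "x = 0"
      by (simp add: w_def symplectic_form_twice matrix_vector_mult_minus_right)
  qed
  from symplectic_basis[OF finite[of "UNIV :: 'n set"] subspace_UNIV this]
  obtain e f and \<nu> :: "'n \<Rightarrow> real" where "canonical_on UNIV e f \<nu>"
    by auto
  then have \<nu>: "\<And>j. 0 < \<nu> j"
    and Bef: "\<And>j l. B (e j) (e l) = (if j = l then \<nu> j else 0)"
      "\<And>j l. B (f j) (f l) = (if j = l then \<nu> j else 0)" "\<And>j l. B (e j) (f l) = 0"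
    and wef: "\<And>j l. w (e j) (e l) = 0" "\<And>j l. w (f j) (f l) = 0"
      "\<And>j l. w (e j) (f l) = (if j = l then 1 else 0)"
    by (auto simp: canonical_on_def)
  define T :: "'n phase_matrix" where
    "T = (\<chi> i p. (if snd p = 1 then e (fst p) else f (fst p)) $ i)"
  have T: "T *v axis (k, 1) 1 = e k" "T *v axis (k, 2) 1 = f k" for k
    by (simp_all add: T_def matrix_vector_mult_basis column_def vec_eq_iff)
  let ?D = "block_diag (\<lambda>k. \<nu> k *\<^sub>R mat 1) :: 'n phase_matrix"
  have D: "transpose T ** \<Sigma> ** T = ?D"
  proof (rule matrix_eq_of_forms)
    fix i j :: "'n \<times> 2"
    obtain k a l b where "i = (k, a)" "j = (l, b)" by (cases i; cases j)
    then show "axis i 1 \<bullet> ((transpose T ** \<Sigma> ** T) *v axis j 1) = axis i 1 \<bullet> (?D *v axis j 1)"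
      using Bef sym[of "f k" "e l"] exhaust_2[of a] exhaust_2[of b]
      by (auto simp: inner_congruence T B_def inner_axis' block_diag_scale_mult_vec axis_component)
  qed
  have W: "transpose T ** symplectic_form ** T = symplectic_form"
  proof (rule matrix_eq_of_forms)
    fix i j :: "'n \<times> 2"
    obtain k a l b where "i = (k, a)" "j = (l, b)" by (cases i; cases j)
    then show "axis i 1 \<bullet> ((transpose T ** symplectic_form ** T) *v axis j 1) =
        axis i 1 \<bullet> (symplectic_form *v axis j 1)"
      using wef alt[of "f k" "e l"] exhaust_2[of a] exhaust_2[of b]
      by (auto simp: inner_congruence T w_def inner_axis' symplectic_form_mult_vec axis_component)
  qed
  \<comment> \<open>Multiplying \<open>W\<close> on the left by minus the symplectic form exhibits a
    left inverse of \<open>T\<close>.\<close>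
  have "- (symplectic_form ** transpose T ** symplectic_form) ** T = mat 1"
    using arg_cong[OF W, of "\<lambda>A. - (symplectic_form ** A)"]
    by (simp add: symplectic_form_squared matrix_mul_assoc matrix_mult_minus_left)
  then obtain R where RT: "R ** T = mat 1" by blast
  then have "T ** R = mat 1" by (simp add: matrix_left_right_inverse)
  then have tr: "transpose R ** transpose T = mat 1"
    by (metis matrix_transpose_mul transpose_mat)
  have cancel: "transpose R ** (transpose T ** A ** T) ** R = A" for A
    using tr \<open>T ** R = mat 1\<close> by (metis matrix_mul_assoc matrix_mul_lid matrix_mul_rid)
  show ?thesis
  proof (rule that)
    show "williamson_form \<Sigma> (transpose R) \<nu>"
      using cancel[of \<Sigma>] cancel[of symplectic_form] \<nu>
      unfolding williamson_form_def symplectic_matrix_def D W by simp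
  qed
qed

section \<open>Symplectic eigenvalues and admissibility\<close>

text \<open>With \<open>J\<close> the symplectic form, the defining identity makes
  \<open>- (J ** transpose S ** J)\<close> a right inverse of \<open>S\<close>. For square matrices
  it is also a left inverse, and multiplying that relation by \<open>J\<close> gives the transposed
  identity.\<close>

lemma symplectic_matrix_dual:
  fixes S :: "'n::finite phase_matrix"
  assumes "symplectic_matrix S"
  shows "transpose S ** symplectic_form ** S = symplectic_form"
    and "invertible (transpose S)"
proof -
  let ?J = "symplectic_form :: 'n phase_matrix"
  have "S ** (- (?J ** transpose S ** ?J)) = - (S ** ?J ** transpose S ** ?J)"
    by (simp add: matrix_mul_assoc matrix_mult_minus_right)
  also have "\<dots> = mat 1"
    using assms by (simp add: symplectic_matrix_def symplectic_form_squared)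
  finally have r: "S ** (- (?J ** transpose S ** ?J)) = mat 1" .
  then have l: "- (?J ** transpose S ** ?J) ** S = mat 1"
    by (simp add: matrix_left_right_inverse)
  from arg_cong[OF l, of "\<lambda>A. ?J ** A"]
  show "transpose S ** ?J ** S = ?J"
    by (simp add: matrix_mul_assoc symplectic_form_squared matrix_mult_minus_left
        matrix_mult_minus_right)
  show "invertible (transpose S)"
    using r l by (metis invertible_def matrix_transpose_mul transpose_mat)
qed

text \<open>The right-hand side mentions neither \<open>S\<close> nor \<open>\<nu>\<close>, which
  yields independence of the chosen form. With \<open>J\<close> the symplectic form and
  \<open>D\<close> the diagonal factor, \<open>transpose S\<close> conjugates
  \<open>J ** \<Sigma>\<close> to \<open>J ** D\<close>. The latter has imaginary eigenvalues, so
  its square is used to stay over the reals.\<close>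

lemma williamson_form_eigenvalues:
  fixes \<Sigma> :: "'n::finite phase_matrix"
  assumes "williamson_form \<Sigma> S \<nu>"
  shows "range \<nu> = {v. 0 < v \<and> (\<exists>x. x \<noteq> 0 \<and>
    symplectic_form *v (\<Sigma> *v (symplectic_form *v (\<Sigma> *v x))) = - (v\<^sup>2) *\<^sub>R x)}"
proof -
  let ?J = "symplectic_form :: 'n phase_matrix"
  let ?D = "block_diag (\<lambda>k. \<nu> k *\<^sub>R mat 1) :: 'n phase_matrix"
  have S: "symplectic_matrix S" and \<nu>: "\<And>k. 0 < \<nu> k" and \<Sigma>: "\<Sigma> = S ** ?D ** transpose S"
    using assms by (auto simp: williamson_form_def)
  note dual = symplectic_matrix_dual[OF S]
  have "transpose S ** (?J ** \<Sigma>) = (transpose S ** ?J ** S) ** ?D ** transpose S"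
    by (simp add: \<Sigma> matrix_mul_assoc)
  then have "transpose S ** (?J ** \<Sigma>) = ?J ** ?D ** transpose S"
    by (simp add: dual)
  from arg_cong[OF this, of "\<lambda>A. A *v x" for x]
  have inter: "transpose S *v (?J *v (\<Sigma> *v x)) = ?J *v (?D *v (transpose S *v x))" for x
    by (simp flip: matrix_vector_mul_assoc)
  have DJ: "?J *v (?D *v (?J *v (?D *v y))) = (\<chi> p. - ((\<nu> (fst p))\<^sup>2 * y $ p))" for y
    by (simp add: vec_eq_modes_iff symplectic_form_mult_vec block_diag_scale_mult_vec
        power2_eq_square)
  have inj: "transpose S *v x = transpose S *v x' \<longleftrightarrow> x = x'" for x x'
    using dual(2) inj_matrix_vector_mult by (metis injD)
  \<comment> \<open>In the coordinates \<open>transpose S *v x\<close> the squared operator is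
    diagonal, so the eigenvalue equation splits into components.\<close>
  have iff: "?J *v (\<Sigma> *v (?J *v (\<Sigma> *v x))) = - (v\<^sup>2) *\<^sub>R x \<longleftrightarrow>
      (\<forall>p. (\<nu> (fst p))\<^sup>2 * (transpose S *v x) $ p = v\<^sup>2 * (transpose S *v x) $ p)" for x v
    by (subst inj[symmetric])
      (simp add: inter DJ matrix_vector_mult_scaleR vec_eq_iff matrix_vector_mult_minus_right
        del: transpose_matrix_vector)
  show ?thesis
  proof (intro equalityI subsetI)
    fix v assume "v \<in> range \<nu>"
    then obtain k where k: "v = \<nu> k" by blast
    obtain x where x: "transpose S *v x = axis (k, 1) 1"
      using dual(2) by (metis invertible_def matrix_vector_mul_assoc matrix_vector_mul_lid)
    then have "x \<noteq> 0" by (auto simp: axis_eq_0_iff)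
    moreover have "?J *v (\<Sigma> *v (?J *v (\<Sigma> *v x))) = - (v\<^sup>2) *\<^sub>R x"
      unfolding iff x by (auto simp: axis_def k)
    ultimately show "v \<in> {v. 0 < v \<and> (\<exists>x. x \<noteq> 0 \<and>
      ?J *v (\<Sigma> *v (?J *v (\<Sigma> *v x))) = - (v\<^sup>2) *\<^sub>R x)}"
      using \<nu> k by blast
  next
    fix v assume "v \<in> {v. 0 < v \<and> (\<exists>x. x \<noteq> 0 \<and>
      ?J *v (\<Sigma> *v (?J *v (\<Sigma> *v x))) = - (v\<^sup>2) *\<^sub>R x)}"
    then obtain x where v: "0 < v" and x: "x \<noteq> 0"
      and eq: "\<And>p. (\<nu> (fst p))\<^sup>2 * (transpose S *v x) $ p = v\<^sup>2 * (transpose S *v x) $ p"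
      unfolding iff by blast
    have "transpose S *v x \<noteq> 0" using inj[of x 0] x by simp
    then obtain p where "(transpose S *v x) $ p \<noteq> 0" by (auto simp: vec_eq_iff)
    then have "(\<nu> (fst p))\<^sup>2 = v\<^sup>2" using eq[of p] by simp
    then have "\<nu> (fst p) = v" using v \<nu>[of "fst p"] by (simp add: power2_eq_iff_nonneg less_imp_le)
    then show "v \<in> range \<nu>" by blast
  qed
qed

text \<open>This reduces the union over all Williamson forms to one finite nonempty set, on which
  \<open>Min\<close> is the true minimum.\<close>

lemma symplectic_eigenvalues_eq_range:
  assumes "williamson_form \<Sigma> S \<nu>"
  shows "symplectic_eigenvalues \<Sigma> = range \<nu>"
proof -
  have "range \<nu>' = range \<nu>" if "williamson_form \<Sigma> S' \<nu>'" for S' \<nu>'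
    using williamson_form_eigenvalues[OF that] williamson_form_eigenvalues[OF assms] by simp
  then show ?thesis
    using assms unfolding symplectic_eigenvalues_def by blast
qed

text \<open>For \<open>z = x + i y\<close> the symmetric part contributes \<open>A\<close> evaluated
  on \<open>x\<close> and on \<open>y\<close>, while the antisymmetric part contributes the cross
  term \<open>-2 c\<close> times the \<open>W\<close>-pairing of \<open>x\<close> and
  \<open>y\<close>.\<close>

lemma hermitian_psd_iff_real:
  fixes A W :: "real ^ 'm ^ 'm"
  assumes A: "transpose A = A" and W: "transpose W = - W"
  shows "hermitian_psd (\<chi> i j. complex_of_real (A $ i $ j)
          + \<i> * complex_of_real c * complex_of_real (W $ i $ j)) \<longleftrightarrow>
    (\<forall>x y. 2 * c * (x \<bullet> (W *v y)) \<le> x \<bullet> (A *v x) + y \<bullet> (A *v y))" (is "hermitian_psd ?M \<longleftrightarrow> _")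
proof -
  have Asym: "A $ j $ i = A $ i $ j" and Wsym: "W $ j $ i = - W $ i $ j" for i j
    using arg_cong[OF A, of "\<lambda>M. M $ i $ j"] arg_cong[OF W, of "\<lambda>M. M $ i $ j"]
    by (simp_all add: transpose_def)
  have alt: "y \<bullet> (W *v x) = - (x \<bullet> (W *v y))" for x y
    using inner_transpose_mult[of x W y]
    by (simp only: W matrix_vector_mult_minus_left inner_minus_right inner_commute)
  have herm: "\<forall>i j. ?M $ j $ i = cnj (?M $ i $ j)"
  proof (intro allI)
    fix i j
    show "?M $ j $ i = cnj (?M $ i $ j)" using Asym[of i j] Wsym[of i j] by simp
  qed
  have form: "u \<bullet> (C *v v) = (\<Sum>i\<in>UNIV. \<Sum>j\<in>UNIV. C $ i $ j * (u $ i * v $ j))"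
    for u v and C :: "real ^ 'm ^ 'm"
    by (simp add: inner_vec_def matrix_vector_mult_def sum_distrib_left algebra_simps)
  have "Re (\<Sum>i\<in>UNIV. cnj (z $ i) * (?M *v z) $ i) = x \<bullet> (A *v x) + y \<bullet> (A *v y)
      - 2 * c * (x \<bullet> (W *v y))" if "x = (\<chi> i. Re (z $ i))" "y = (\<chi> i. Im (z $ i))" for z x y
  proof -
    have "Re (\<Sum>i\<in>UNIV. cnj (z $ i) * (?M *v z) $ i) =
        (\<Sum>i\<in>UNIV. \<Sum>j\<in>UNIV. Re (cnj (z $ i) * (?M $ i $ j * z $ j)))"
      by (simp only: matrix_vector_mult_def sum_distrib_left Re_sum vec_lambda_beta)
    also have "\<dots> = (\<Sum>i\<in>UNIV. \<Sum>j\<in>UNIV. A $ i $ j * (x $ i * x $ j) + A $ i $ j * (y $ i * y $ j)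
        - c * (W $ i $ j * (x $ i * y $ j)) + c * (W $ i $ j * (y $ i * x $ j)))"
      by (intro sum.cong refl) (simp add: that algebra_simps)
    also have "\<dots> = x \<bullet> (A *v x) + y \<bullet> (A *v y) - c * (x \<bullet> (W *v y)) + c * (y \<bullet> (W *v x))"
      by (simp add: form sum.distrib sum_subtractf sum_distrib_left)
    finally show ?thesis by (simp add: alt[of y x])
  qed
  note re = this[OF refl refl]
  have "(\<forall>z. 0 \<le> Re (\<Sum>i\<in>UNIV. cnj (z $ i) * (?M *v z) $ i)) \<longleftrightarrow>
    (\<forall>x y. 2 * c * (x \<bullet> (W *v y)) \<le> x \<bullet> (A *v x) + y \<bullet> (A *v y))" (is "?L \<longleftrightarrow> ?R")
  proof
    assume L: ?L
    show ?R
    proof (intro allI)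
      fix x y :: "real ^ 'm"
      show "2 * c * (x \<bullet> (W *v y)) \<le> x \<bullet> (A *v x) + y \<bullet> (A *v y)"
        using L[rule_format, of "\<chi> i. Complex (x $ i) (y $ i)"] unfolding re by simp
    qed
  next
    assume ?R
    then show ?L unfolding re by simp
  qed
  with herm show ?thesis unfolding hermitian_psd_def by blast
qed

text \<open>Here \<open>(a, b)\<close> and \<open>(c, d)\<close> are the components of two vectors
  in one mode and \<open>a * d - b * c\<close> is their symplectic pairing. For \<open>v = m\<close>
  the difference of the two sides is the sum of squares used in the proof.\<close>

lemma one_mode_bound:
  fixes a b c d :: real
  assumes "0 < m" "m \<le> v"
  shows "2 * m * (a * d - b * c) \<le> v * (a\<^sup>2 + b\<^sup>2) + v * (c\<^sup>2 + d\<^sup>2)"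
proof -
  have "0 \<le> m * ((a - d)\<^sup>2 + (b + c)\<^sup>2)" using assms by simp
  then have "2 * m * (a * d - b * c) \<le> m * (a\<^sup>2 + b\<^sup>2 + c\<^sup>2 + d\<^sup>2)"
    by (simp add: power2_eq_square algebra_simps)
  also have "\<dots> \<le> v * (a\<^sup>2 + b\<^sup>2 + c\<^sup>2 + d\<^sup>2)"
    using assms by (intro mult_right_mono) auto
  finally show ?thesis by (simp add: algebra_simps)
qed

text \<open>Passing to \<open>transpose S *v x\<close> preserves the symplectic pairing and makes
  \<open>\<Sigma>\<close> diagonal, so the real inequality becomes a sum over modes.\<close>

lemma quantum_admissible_iff:
  fixes \<Sigma> :: "'n::finite phase_matrix"
  assumes "0 < hbar" "\<Sigma> \<in> pos_def_sym" "williamson_form \<Sigma> S \<nu>"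
  shows "\<Sigma> \<in> quantum_admissible hbar \<longleftrightarrow> (\<forall>k. hbar / 2 \<le> \<nu> k)"
proof -
  let ?J = "symplectic_form :: 'n phase_matrix"
  let ?D = "block_diag (\<lambda>k. \<nu> k *\<^sub>R mat 1) :: 'n phase_matrix"
  have S: "symplectic_matrix S" and \<nu>: "\<And>k. 0 < \<nu> k" and \<Sigma>: "\<Sigma> = S ** ?D ** transpose S"
    using assms by (auto simp: williamson_form_def)
  have cong: "x \<bullet> ((S ** A ** transpose S) *v y) = (transpose S *v x) \<bullet> (A *v (transpose S *v y))"
    for x y A using inner_congruence[of x "transpose S" A y] by simp
  have J: "x \<bullet> (?J *v y) = (transpose S *v x) \<bullet> (?J *v (transpose S *v y))" for x y
    using cong[of x ?J y] S by (simp add: symplectic_matrix_def)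
  have surj: "\<exists>x. u = transpose S *v x" for u
    using symplectic_matrix_dual(2)[OF S]
    by (metis invertible_def matrix_vector_mul_assoc matrix_vector_mul_lid)
  have Jt: "transpose ?J = - ?J"
  proof (rule matrix_eq_of_forms)
    fix i j :: "'n \<times> 2"
    show "axis i 1 \<bullet> (transpose ?J *v axis j 1) = axis i 1 \<bullet> (- ?J *v axis j 1)"
      using symplectic_form_alternating[of "axis j 1" "axis i 1"]
      by (simp only: inner_transpose_mult inner_commute[of _ "axis j 1"]
          matrix_vector_mult_minus_left inner_minus_right)
  qed
  have "\<Sigma> \<in> quantum_admissible hbar \<longleftrightarrow>
    (\<forall>x y. 2 * (hbar / 2) * (x \<bullet> (?J *v y)) \<le> x \<bullet> (\<Sigma> *v x) + y \<bullet> (\<Sigma> *v y))"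
    using hermitian_psd_iff_real[OF _ Jt, of \<Sigma> "hbar / 2"] assms(2)
    unfolding quantum_admissible_def pos_def_sym_def by simp
  also have "\<dots> \<longleftrightarrow> (\<forall>u v. 2 * (hbar / 2) * (u \<bullet> (?J *v v)) \<le> u \<bullet> (?D *v u) + v \<bullet> (?D *v v))"
  proof -
    have "x \<bullet> (\<Sigma> *v x) = (transpose S *v x) \<bullet> (?D *v (transpose S *v x))" for x
      unfolding \<Sigma> by (rule cong)
    then show ?thesis using surj J by metis
  qed
  also have "\<dots> \<longleftrightarrow> (\<forall>k. hbar / 2 \<le> \<nu> k)" (is "?L \<longleftrightarrow> ?R")
  proof
    assume L: ?L
    show ?R
    proof
      fix k
      \<comment> \<open>The two coordinate vectors of mode \<open>k\<close> are extremal: the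
        inequality reduces to \<open>hbar \<le> 2 * \<nu> k\<close>.\<close>
      have "2 * (hbar / 2) * (axis (k, 1) 1 \<bullet> (?J *v axis (k, 2) 1)) \<le>
        axis (k, 1) 1 \<bullet> (?D *v axis (k, 1) 1) + axis (k, 2) 1 \<bullet> (?D *v axis (k, 2) 1)"
        using L by blast
      then show "hbar / 2 \<le> \<nu> k"
        by (simp add: inner_axis' symplectic_form_mult_vec block_diag_scale_mult_vec)
    qed
  next
    assume R: ?R
    show ?L
    proof (intro allI)
      fix u v :: "real ^ ('n \<times> 2)"
      have "(\<Sum>k\<in>UNIV. 2 * (hbar / 2) * (u $ (k, 1) * v $ (k, 2) - u $ (k, 2) * v $ (k, 1))) \<le>
        (\<Sum>k\<in>UNIV. \<nu> k * ((u $ (k, 1))\<^sup>2 + (u $ (k, 2))\<^sup>2) +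
          \<nu> k * ((v $ (k, 1))\<^sup>2 + (v $ (k, 2))\<^sup>2))"
        using R assms(1) by (intro sum_mono one_mode_bound) auto
      then show "2 * (hbar / 2) * (u \<bullet> (?J *v v)) \<le> u \<bullet> (?D *v u) + v \<bullet> (?D *v v)"
        by (simp add: inner_modes symplectic_form_mult_vec block_diag_scale_mult_vec
            sum_distrib_left sum.distrib sum_subtractf power2_eq_square algebra_simps)
    qed
  qed
  finally show ?thesis .
qed

section \<open>Dilations and the first meeting with the boundary\<close>

lemma williamson_form_scaleR:
  assumes "williamson_form \<Sigma> S \<nu>" "0 < c"
  shows "williamson_form (c *\<^sub>R \<Sigma>) S (\<lambda>k. c * \<nu> k)"
proof -
  have "block_diag (\<lambda>k. (c * \<nu> k) *\<^sub>R mat 1) = c *\<^sub>R block_diag (\<lambda>k. \<nu> k *\<^sub>R mat 1)"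
    by (simp add: block_diag_def vec_eq_iff)
  then show ?thesis
    using assms by (simp add: williamson_form_def scalar_matrix_assoc matrix_scalar_ac)
qed

lemma pos_def_sym_scaleR:
  assumes "\<Sigma> \<in> pos_def_sym" "0 < c"
  shows "c *\<^sub>R \<Sigma> \<in> pos_def_sym"
  using assms
  by (simp add: pos_def_sym_def transpose_scalar scaleR_matrix_vector_assoc[symmetric])

theorem proposition1:
  fixes hbar :: real and \<Sigma>0 :: "real ^ ('n::finite \<times> 2) ^ ('n \<times> 2)"
  assumes "0 < hbar"
    and "\<Sigma>0 \<in> quantum_interior hbar"
  shows "(\<forall>s\<le>0. exp s *\<^sub>R \<Sigma>0 \<in> quantum_admissible hbar
            \<longleftrightarrow> hbar / 2 \<le> exp s * min_symplectic_eigenvalue \<Sigma>0) \<and>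
         (let s_star = ln (hbar / (2 * min_symplectic_eigenvalue \<Sigma>0))
          in s_star < 0 \<and>
             exp s_star *\<^sub>R \<Sigma>0 \<in> quantum_boundary hbar \<and>
             (\<forall>s. s_star < s \<and> s \<le> 0 \<longrightarrow> exp s *\<^sub>R \<Sigma>0 \<notin> quantum_boundary hbar))"
proof -
  have pd: "\<Sigma>0 \<in> pos_def_sym"
    using assms(2) by (simp add: quantum_interior_def quantum_admissible_def)
  obtain S \<nu> where W: "williamson_form \<Sigma>0 S \<nu>"
    using williamson[OF pd] .
  define m where "m = min_symplectic_eigenvalue \<Sigma>0"
  have m: "m = Min (range \<nu>)"
    by (simp add: m_def min_symplectic_eigenvalue_def symplectic_eigenvalues_eq_range[OF W])
  have le: "m \<le> \<nu> k" for k by (simp add: m)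
  have "m \<in> range \<nu>" unfolding m by (rule Min_in) auto
  then obtain k0 where k0: "m = \<nu> k0" by blast
  have big: "hbar / 2 < m"
    using assms(2) unfolding k0
    by (simp add: quantum_interior_def symplectic_eigenvalues_eq_range[OF W])
  \<comment> \<open>One matrix \<open>S\<close> serves the whole orbit; only the eigenvalues are
    rescaled.\<close>
  have Ws: "williamson_form (exp s *\<^sub>R \<Sigma>0) S (\<lambda>k. exp s * \<nu> k)" for s
    using W by (simp add: williamson_form_scaleR)
  have adm: "exp s *\<^sub>R \<Sigma>0 \<in> quantum_admissible hbar \<longleftrightarrow> hbar / 2 \<le> exp s * m" for s
  proof -
    have "exp s *\<^sub>R \<Sigma>0 \<in> quantum_admissible hbar \<longleftrightarrow> (\<forall>k. hbar / 2 \<le> exp s * \<nu> k)"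
      using quantum_admissible_iff[OF assms(1) _ Ws] pos_def_sym_scaleR[OF pd] by simp
    also have "\<dots> \<longleftrightarrow> hbar / 2 \<le> exp s * m"
      using le k0 by (metis exp_ge_zero mult_left_mono order_trans)
    finally show ?thesis .
  qed
  have bd: "exp s *\<^sub>R \<Sigma>0 \<in> quantum_boundary hbar \<longleftrightarrow>
      hbar / 2 \<le> exp s * m \<and> (\<exists>k. exp s * \<nu> k = hbar / 2)" for s
    unfolding quantum_boundary_def by (auto simp: adm symplectic_eigenvalues_eq_range[OF Ws])
  \<comment> \<open>This \<open>t\<close> solves \<open>exp t * m = hbar / 2\<close>; it is negative
    because \<open>m\<close> exceeds \<open>hbar / 2\<close> strictly.\<close>
  define t where "t = ln (hbar / (2 * m))"
  have m0: "0 < m" using big assms(1) by linarith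
  have et: "exp t = hbar / (2 * m)" using m0 assms(1) by (simp add: t_def)
  then have etm: "exp t * m = hbar / 2" using m0 by simp
  have "t < 0" using big m0 assms(1) by (simp add: t_def ln_less_zero field_simps)
  moreover have "exp t *\<^sub>R \<Sigma>0 \<in> quantum_boundary hbar"
    using etm unfolding bd k0 by auto
  moreover have "exp s *\<^sub>R \<Sigma>0 \<notin> quantum_boundary hbar" if "t < s" for s
  proof -
    \<comment> \<open>After \<open>t\<close> even the smallest eigenvalue is strictly above the
      threshold, so no mode can attain it.\<close>
    have "hbar / 2 < exp s * \<nu> k" for k
    proof -
      have "hbar / 2 = exp t * m" using etm by simp
      also have "\<dots> < exp s * m" using that m0 by simp
      also have "\<dots> \<le> exp s * \<nu> k" using le by simp
      finally show ?thesis .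
    qed
    then show ?thesis unfolding bd by (metis less_irrefl)
  qed
  ultimately show ?thesis
    by (simp add: adm Let_def t_def flip: m_def)
qed

end
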